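(* Every graph in $\varepsilon_{23}$ is planar.
   Context: All graphs are finite, simple and connected. An Euler graph is a connected graph all of whose nodes have even degree. $\varepsilon_{23}$ is the class of Euler graphs in which every cycle has length $\equiv 2$ or $\equiv 3\pmod 4$ and which contain at least one cycle of each of these two kinds. *)

theory Defs
  imports "HOL-Analysis.Analysis" "Graph_Theory.Graph_Theory"
begin

text \<open>
  A finite simple graph is a finite, symmetric, loop-free set of ordered pairs
  (locale \<^locale>\<open>pair_graph\<close>): the edge joining \<open>u\<close> and \<open>v\<close> is the pair of opposite arcs
  \<open>(u, v)\<close>, \<open>(v, u)\<close>, so the degree of a node is its out-degree.
\<close>

text \<open>
  In a symmetric digraph the closed walk \<open>u, v, u\<close> along a single edge satisfies
  \<^const>\<open>pre_digraph.cycle\<close>, but it is not a cycle of the undirected graph; the bound on the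
  length excludes exactly these walks.
\<close>

definition graph_cycle :: "'a pair_pre_digraph \<Rightarrow> ('a \<times> 'a) list \<Rightarrow> bool" where
  "graph_cycle G p \<longleftrightarrow> pre_digraph.cycle (with_proj G) p \<and> 3 \<le> length p"

definition euler_graph :: "'a pair_pre_digraph \<Rightarrow> bool" where
  "euler_graph G \<longleftrightarrow>
     pair_graph G \<and> Digraph_Component.connected (with_proj G) \<and>
     (\<forall>v \<in> pverts G. even (out_degree (with_proj G) v))"

definition eps23 :: "'a pair_pre_digraph set" where
  "eps23 = {G. euler_graph G \<and>
     (\<forall>p. graph_cycle G p \<longrightarrow> length p mod 4 = 2 \<or> length p mod 4 = 3) \<and>
     (\<exists>p. graph_cycle G p \<and> length p mod 4 = 2) \<and>
     (\<exists>p. graph_cycle G p \<and> length p mod 4 = 3)}"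

text \<open>
  A drawing without crossings: nodes become distinct points and edges become simple arcs joining
  their end points; an arc meets the drawn nodes only in its own end points, and arcs of different
  edges meet only in drawn nodes, that is, in common end points. The two orientations of an edge
  are drawn as the same curve.
\<close>

definition plane_embedding ::
  "'a pair_pre_digraph \<Rightarrow> ('a \<Rightarrow> complex) \<Rightarrow> ('a \<times> 'a \<Rightarrow> real \<Rightarrow> complex) \<Rightarrow> bool" where
  "plane_embedding G \<phi> \<gamma> \<longleftrightarrow>
     inj_on \<phi> (pverts G) \<and>
     (\<forall>(u, v) \<in> parcs G.
        arc (\<gamma> (u, v)) \<and> pathstart (\<gamma> (u, v)) = \<phi> u \<and> pathfinish (\<gamma> (u, v)) = \<phi> v \<and>
        \<gamma> (v, u) = reversepath (\<gamma> (u, v)) \<and>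
        path_image (\<gamma> (u, v)) \<inter> \<phi> ` pverts G = {\<phi> u, \<phi> v}) \<and>
     (\<forall>e \<in> parcs G. \<forall>f \<in> parcs G. f \<noteq> e \<and> f \<noteq> prod.swap e \<longrightarrow>
        path_image (\<gamma> e) \<inter> path_image (\<gamma> f) \<subseteq> \<phi> ` pverts G)"

definition planar :: "'a pair_pre_digraph \<Rightarrow> bool" where
  "planar G \<longleftrightarrow> (\<exists>\<phi> \<gamma>. plane_embedding G \<phi> \<gamma>)"

end

theory Submission
  imports Defs
begin

text \<open>
  Give the edges weights and suppose that every cycle has weight 2 or 3 modulo 4. Such a graph
  contains no subdivided \<open>K\<^sub>4\<close>: if two of its four triangles share the path \<open>z\<close>, the third cycle of
  the resulting theta graph shows that \<open>2z\<close> is the sum of the two triangles minus a quadrilateral,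
  so the parity of each of the six paths is determined by the parities of the seven cycles, and the
  six conditions contradict each other. A graph of minimum degree 3 does contain a subdivided
  \<open>K\<^sub>4\<close>, hence some node has at most two neighbours. The node is deleted or suppressed; suppressing
  it adds the two weights, which keeps the condition on cycles. By induction the graph is a
  subgraph of a 2-tree, and 2-trees have straight-line drawings, since a new node can be placed
  close to the midpoint of the edge to which it is attached.
\<close>

section \<open>Weighted walks and cycles\<close>

fun walk_weight :: "('a \<Rightarrow> 'a \<Rightarrow> nat) \<Rightarrow> 'a list \<Rightarrow> nat" where
  "walk_weight w (x # y # zs) = w x y + walk_weight w (y # zs)"
| "walk_weight w _ = 0"

definition vertex_cycle :: "('a \<times> 'a) set \<Rightarrow> 'a list \<Rightarrow> bool" where
  "vertex_cycle E p \<longleftrightarrow> distinct p \<and> 3 \<le> length p \<and>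
     successively (\<lambda>a b. (a, b) \<in> E) p \<and> (last p, hd p) \<in> E"

definition cycle_weight :: "('a \<Rightarrow> 'a \<Rightarrow> nat) \<Rightarrow> 'a list \<Rightarrow> nat" where
  "cycle_weight w p = walk_weight w p + w (last p) (hd p)"

text \<open>Weights replace edge counts because, after suppressions, an edge stands for a whole path
  of the original graph and carries the length of that path.\<close>

definition cycles_2_or_3 :: "('a \<times> 'a) set \<Rightarrow> ('a \<Rightarrow> 'a \<Rightarrow> nat) \<Rightarrow> bool" where
  "cycles_2_or_3 E w \<longleftrightarrow>
     (\<forall>p. vertex_cycle E p \<longrightarrow> cycle_weight w p mod 4 = 2 \<or> cycle_weight w p mod 4 = 3)"

lemma walk_weight_append:
  "p \<noteq> [] \<Longrightarrow> q \<noteq> [] \<Longrightarrow>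
     walk_weight w (p @ q) = walk_weight w p + w (last p) (hd q) + walk_weight w q"
  by (induction w p rule: walk_weight.induct) (auto simp: neq_Nil_conv)

lemma walk_weight_Cons: "p \<noteq> [] \<Longrightarrow> walk_weight w (x # p) = w x (hd p) + walk_weight w p"
  by (cases p) auto

lemma walk_weight_rev:
  assumes "\<And>a b. w a b = w b a"
  shows "walk_weight w (rev p) = walk_weight w p"
proof (induction p)
  case (Cons a p)
  then show ?case
    by (cases "p = []") (simp_all add: walk_weight_append walk_weight_Cons last_rev assms)
qed simp

lemma walk_weight_cong:
  "successively (\<lambda>a b. w a b = w' a b) p \<Longrightarrow> walk_weight w p = walk_weight w' p"
  by (induction w p rule: walk_weight.induct) auto

lemma successively_rev_sym:
  "sym E \<Longrightarrow> successively (\<lambda>a b. (a, b) \<in> E) (rev p) = successively (\<lambda>a b. (a, b) \<in> E) p"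
  by (auto dest: symD elim: successively_mono)

lemma not_successively_split:
  "\<not> successively P p \<Longrightarrow> \<exists>q a b r. p = q @ a # b # r \<and> \<not> P a b"
proof (induction P p rule: successively.induct)
  case (3 P x y xs)
  show ?case
  proof (cases "P x y")
    case True
    with 3 obtain q a b r where "y # xs = q @ a # b # r" "\<not> P a b" by auto
    then show ?thesis by (intro exI[of _ "x # q"]) auto
  next
    case False
    then show ?thesis by (intro exI[of _ "[]"]) auto
  qed
qed auto

text \<open>Any edge of a cycle can be moved to the closing position from \<open>last\<close> to
  \<open>hd\<close>, so that a distinguished edge need only be studied there.\<close>

lemma vertex_cycle_rotate:
  "vertex_cycle E (p @ q) \<Longrightarrow> vertex_cycle E (q @ p)"
  by (cases "p = []"; cases "q = []")
    (auto simp: vertex_cycle_def successively_append_iff)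

lemma cycle_weight_rotate: "cycle_weight w (p @ q) = cycle_weight w (q @ p)"
  by (cases "p = []"; cases "q = []") (auto simp: cycle_weight_def walk_weight_append)

section \<open>Exclusion of a subdivided \<open>K4\<close>\<close>

text \<open>The numbers are the weights of the six paths, with opposite pairs \<open>a\<close>,
  \<open>d\<close> and \<open>b\<close>, \<open>f\<close> and \<open>c\<close>, \<open>e\<close>.
  The first four assumptions concern the triangles, the last three the quadrilaterals, each of which
  avoids one opposite pair.\<close>

lemma K4_arith:
  fixes a b c d e f :: nat
  assumes "(a+b+c) mod 4 = 2 \<or> (a+b+c) mod 4 = 3"
    "(b+d+e) mod 4 = 2 \<or> (b+d+e) mod 4 = 3"
    "(c+d+f) mod 4 = 2 \<or> (c+d+f) mod 4 = 3"
    "(a+e+f) mod 4 = 2 \<or> (a+e+f) mod 4 = 3"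
    "(a+f+d+b) mod 4 = 2 \<or> (a+f+d+b) mod 4 = 3"
    "(a+c+d+e) mod 4 = 2 \<or> (a+c+d+e) mod 4 = 3"
    "(b+c+f+e) mod 4 = 2 \<or> (b+c+f+e) mod 4 = 3"
  shows False
proof -
  \<comment> \<open>\<open>s\<close> and \<open>t\<close> are triangles sharing the path
    \<open>z\<close>, and \<open>q\<close> is the quadrilateral formed by their other paths. Modulo
    4, \<open>s + t - q\<close> must be 0 or 2, and it is 0 only for the residues 3, 3 and
    2.\<close>
  have par: "even z \<longleftrightarrow> odd s \<and> odd t \<and> even q"
    if "s mod 4 = 2 \<or> s mod 4 = 3" "t mod 4 = 2 \<or> t mod 4 = 3"
      "q mod 4 = 2 \<or> q mod 4 = 3" "s + t = q + 2 * z" for s t q z :: nat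
  proof -
    have good: "even n \<longleftrightarrow> n mod 4 = 2" if "n mod 4 = 2 \<or> n mod 4 = 3" for n :: nat
      using that by presburger
    have "2 * z mod 4 = (if even z then 0 else 2)" by presburger
    moreover have "(s mod 4 + t mod 4) mod 4 = (q mod 4 + 2 * z mod 4) mod 4"
      using that(4) by (simp add: mod_add_eq)
    ultimately show ?thesis
      using that(1-3) unfolding that(1-3)[THEN good] by (auto split: if_splits)
  qed
  have "even a \<longleftrightarrow> odd (a+b+c) \<and> odd (a+e+f) \<and> even (b+c+f+e)"
    by (rule par[OF assms(1,4,7)]) simp
  moreover have "even b \<longleftrightarrow> odd (a+b+c) \<and> odd (b+d+e) \<and> even (a+c+d+e)"
    by (rule par[OF assms(1,2,6)]) simp
  moreover have "even c \<longleftrightarrow> odd (a+b+c) \<and> odd (c+d+f) \<and> even (a+f+d+b)"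
    by (rule par[OF assms(1,3,5)]) simp
  moreover have "even d \<longleftrightarrow> odd (b+d+e) \<and> odd (c+d+f) \<and> even (b+c+f+e)"
    by (rule par[OF assms(2,3,7)]) simp
  moreover have "even e \<longleftrightarrow> odd (b+d+e) \<and> odd (a+e+f) \<and> even (a+f+d+b)"
    by (rule par[OF assms(2,4,5)]) simp
  moreover have "even f \<longleftrightarrow> odd (c+d+f) \<and> odd (a+e+f) \<and> even (a+c+d+e)"
    by (rule par[OF assms(3,4,6)]) simp
  \<comment> \<open>In an even triangle all three paths would be odd, which makes the triangle odd;
    so every triangle is odd. Then a path is even iff the quadrilateral avoiding it is even.
    Opposite paths avoid the same quadrilateral, so they have equal parity and all quadrilaterals
    are even. Now all paths are even, hence so are the triangles, a contradiction.\<close>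
  ultimately show False
    unfolding even_add by argo
qed

text \<open>The branch nodes are \<open>hd xs\<close>, \<open>last xs\<close>, \<open>hd ys\<close>
  and \<open>last ys\<close>. Three of the six paths are single edges, two are \<open>xs\<close> and
  \<open>ys\<close>, and the sixth runs from \<open>last ys\<close> through \<open>zs\<close> to
  \<open>last xs\<close>.\<close>

lemma no_subdivided_K4:
  assumes E: "sym E" and w: "\<And>a b. w a b = w b a" and cyc: "cycles_2_or_3 E w"
    and dist: "distinct (xs @ ys @ zs)" and len: "2 \<le> length xs" "2 \<le> length ys"
    and paths: "successively (\<lambda>a b. (a, b) \<in> E) xs" "successively (\<lambda>a b. (a, b) \<in> E) (ys @ zs)"
    and edges: "(hd xs, hd ys) \<in> E" "(last xs, hd ys) \<in> E" "(hd xs, last ys) \<in> E"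
      "(last xs, last (ys @ zs)) \<in> E"
  shows False
proof -
  obtain x xs' x' where xs: "xs = x # xs' @ [x']"
    using len(1) by (cases xs; cases "tl xs" rule: rev_cases) auto
  obtain y ys' y' where ys: "ys = y # ys' @ [y']"
    using len(2) by (cases ys; cases "tl ys" rule: rev_cases) auto
  note sy = E[THEN symD]
  have sE: "(a, b) \<in> E \<longleftrightarrow> (b, a) \<in> E" for a b using sy by blast
  have good: "cycle_weight w p mod 4 = 2 \<or> cycle_weight w p mod 4 = 3" if "vertex_cycle E p" for p
    using cyc that by (auto simp: cycles_2_or_3_def)
  \<comment> \<open>The neighbour of \<open>x'\<close> on the sixth path; it is \<open>y'\<close> if
    \<open>zs\<close> is empty.\<close>
  define z where "z = last (y' # zs)"
  have z: "(x', z) \<in> E" "last (ys @ zs) = z" using edges(4) by (auto simp: xs ys z_def)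
  have zr: "hd (rev zs @ y' # r) = z" for r
    by (cases zs rule: rev_cases) (auto simp: z_def)
  have ed: "(x, y) \<in> E" "(x', y) \<in> E" "(x, y') \<in> E" using edges by (auto simp: xs ys)
  have px: "successively (\<lambda>a b. (a, b) \<in> E) (x # xs' @ [x'])" using paths xs by simp
  have py: "successively (\<lambda>a b. (a, b) \<in> E) (y # ys' @ [y'])"
    and pz: "successively (\<lambda>a b. (a, b) \<in> E) (y' # zs)"
    using paths(2) successively_append_iff[of _ "y # ys' @ [y']" zs]
    by (auto simp: ys successively_Cons[of _ y' zs])
  have pyz: "successively (\<lambda>a b. (a, b) \<in> E) (y # ys' @ y' # zs)" using paths(2) ys by simp
  have pyr: "successively (\<lambda>a b. (a, b) \<in> E) (rev (y # ys' @ y' # zs))"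
    and pzr: "successively (\<lambda>a b. (a, b) \<in> E) (rev (y' # zs))"
    using pyz pz by (simp_all only: successively_rev_sym[OF E])
  define A where "A = walk_weight w (x # xs' @ [x'])"
  define D where "D = walk_weight w (y # ys' @ [y'])"
  define Z where "Z = walk_weight w (y' # zs)"
  define F where "F = Z + w x' z"
  have Zr: "walk_weight w (rev zs @ [y']) = Z"
    using walk_weight_rev[of w "y' # zs"] w by (simp add: Z_def)
  have DZ: "walk_weight w (y # ys' @ y' # zs) = D + Z"
    using walk_weight_append[of "y # ys' @ [y']" zs w] walk_weight_Cons[of zs w y']
    by (cases "zs = []") (simp_all add: D_def Z_def)
  have DZr: "walk_weight w (rev (y # ys' @ y' # zs)) = D + Z"
    by (subst walk_weight_rev) (auto simp: DZ w simp del: rev.simps)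
  \<comment> \<open>\<open>c1\<close> to \<open>c4\<close> are the triangles and \<open>c5\<close>
    to \<open>c7\<close> the quadrilaterals, in the order of the assumptions of
    \<open>K4_arith\<close>; \<open>A\<close>, \<open>D\<close> and \<open>F\<close> take the places
    of \<open>a\<close>, \<open>d\<close> and \<open>f\<close>.\<close>
  have c1: "vertex_cycle E ((x # xs' @ [x']) @ [y])"
    unfolding vertex_cycle_def successively_append_iff using px ed dist
    by (auto simp: xs ys sE)
  have w1: "cycle_weight w ((x # xs' @ [x']) @ [y]) = A + w x y + w x' y"
    unfolding cycle_weight_def by (subst walk_weight_append) (auto simp: A_def w)
  have c2: "vertex_cycle E (x # y # ys' @ [y'])"
    using py ed dist by (auto simp: vertex_cycle_def xs ys sE)
  have w2: "cycle_weight w (x # y # ys' @ [y']) = w x y + D + w x y'"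
    unfolding cycle_weight_def by (auto simp: D_def w)
  have c3: "vertex_cycle E (x' # y # ys' @ y' # zs)"
    using pyz ed z dist by (auto simp: vertex_cycle_def xs ys sE z_def)
  have w3: "cycle_weight w (x' # y # ys' @ y' # zs) = w x' y + D + F"
    unfolding cycle_weight_def by (auto simp: DZ w F_def z_def)
  have c4: "vertex_cycle E ((x # xs' @ [x']) @ (rev zs @ [y']))"
    unfolding vertex_cycle_def successively_append_iff[of _ "x # xs' @ [x']"]
    using px pzr ed z dist by (auto simp: xs ys sE zr)
  have w4: "cycle_weight w ((x # xs' @ [x']) @ (rev zs @ [y'])) = A + w x y' + F"
    unfolding cycle_weight_def by (subst walk_weight_append) (auto simp: A_def Zr zr F_def w)
  have c5: "vertex_cycle E ((x # xs' @ [x']) @ rev (y # ys' @ y' # zs))"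
    unfolding vertex_cycle_def successively_append_iff[of _ "x # xs' @ [x']"]
    using px pyr ed z dist by (auto simp: xs ys sE zr)
  have w5: "cycle_weight w ((x # xs' @ [x']) @ rev (y # ys' @ y' # zs)) = A + F + D + w x y"
    unfolding cycle_weight_def
    by (subst walk_weight_append, simp, simp, subst DZr) (auto simp: A_def zr F_def w)
  have c6: "vertex_cycle E ((x # xs' @ [x']) @ (y # ys' @ [y']))"
    unfolding vertex_cycle_def successively_append_iff[of _ "x # xs' @ [x']"]
    using px py ed dist by (auto simp: xs ys sE)
  have w6: "cycle_weight w ((x # xs' @ [x']) @ (y # ys' @ [y'])) = A + w x' y + D + w x y'"
    unfolding cycle_weight_def by (subst walk_weight_append) (auto simp: A_def D_def w)
  have c7: "vertex_cycle E ([x, y, x'] @ (rev zs @ [y']))"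
    unfolding vertex_cycle_def successively_append_iff[of _ "[x, y, x']"]
    using pzr ed z dist by (auto simp: xs ys sE zr)
  have w7: "cycle_weight w ([x, y, x'] @ (rev zs @ [y'])) = w x y + w x' y + F + w x y'"
    unfolding cycle_weight_def by (subst walk_weight_append) (auto simp: Zr zr F_def w)
  show False
    using K4_arith[OF good[OF c1, unfolded w1] good[OF c2, unfolded w2] good[OF c3, unfolded w3]
      good[OF c4, unfolded w4] good[OF c5, unfolded w5] good[OF c6, unfolded w6]
      good[OF c7, unfolded w7]] .
qed

section \<open>A node with at most two neighbours\<close>

text \<open>The ends of \<open>xs\<close> are both adjacent to \<open>hd q\<close>, and each has a
  further neighbour on \<open>q\<close>. With \<open>q ! m\<close> as the fourth branch node, the
  stretch of \<open>q\<close> from index \<open>m\<close> to index \<open>l\<close> completes a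
  subdivided \<open>K4\<close>.\<close>

lemma no_path_with_two_chords_from_ends:
  assumes E: "sym E" and w: "\<And>a b. w a b = w b a" and cyc: "cycles_2_or_3 E w"
    and dist: "distinct (xs @ q)" and len: "2 \<le> length xs"
    and paths: "successively (\<lambda>a b. (a, b) \<in> E) xs" "successively (\<lambda>a b. (a, b) \<in> E) q"
    and edges: "(hd xs, hd q) \<in> E" "(last xs, hd q) \<in> E" "(hd xs, q ! m) \<in> E" "(last xs, q ! l) \<in> E"
    and ml: "1 \<le> m" "m \<le> l" "l < length q"
  shows False
proof -
  \<comment> \<open>The nodes of \<open>q\<close> beyond index \<open>l\<close> are cut off.
    \<open>1 \<le> m\<close> gives \<open>ys\<close> its two nodes, and \<open>zs\<close> is empty
    for \<open>m = l\<close>.\<close>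
  define ys where "ys = take (Suc m) q"
  define zs where "zs = drop (Suc m) (take (Suc l) q)"
  have yz: "ys @ zs = take (Suc l) q"
    using ml append_take_drop_id[of "Suc m" "take (Suc l) q"] by (simp add: ys_def zs_def min_absorb1)
  have q: "q = (ys @ zs) @ drop (Suc l) q" by (simp add: yz)
  have "last ys = q ! m" "length ys = Suc m"
    using ml by (auto simp: ys_def take_Suc_conv_app_nth)
  moreover have "last (ys @ zs) = q ! l"
    using ml by (simp add: yz take_Suc_conv_app_nth)
  moreover have "hd ys = hd q" using ml by (auto simp: ys_def hd_take)
  moreover have "successively (\<lambda>a b. (a, b) \<in> E) (ys @ zs)"
    using paths(2) by (subst (asm) q) (simp only: successively_append_iff)
  moreover have "distinct (xs @ ys @ zs)"
  proof -
    have "distinct ((xs @ ys @ zs) @ drop (Suc l) q)" using dist q by simp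
    then show ?thesis by (simp only: distinct_append)
  qed
  ultimately show False
    using no_subdivided_K4[OF E w cyc, of xs ys zs] len paths(1) edges ml(1) by auto
qed

text \<open>
  Among all longest paths and all neighbours of their first nodes, take a neighbour with the least
  index \<open>i \<ge> 2\<close>. Rotating the path at this neighbour gives a longest path that starts at index
  \<open>i - 1\<close>, and minimality forces both first nodes to have a neighbour beyond index \<open>i\<close>.
\<close>

lemma degree_le_2_vertex:
  assumes "finite V" "V \<noteq> {}" and EV: "E \<subseteq> V \<times> V" and E: "sym E" and irr: "\<And>a. (a, a) \<notin> E"
    and w: "\<And>a b. w a b = w b a" and cyc: "cycles_2_or_3 E w"
  shows "\<exists>v\<in>V. card {u. (v, u) \<in> E} \<le> 2"
proof (rule ccontr)
  assume neg: "\<not> ?thesis"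
  define path where "path p \<longleftrightarrow> distinct p \<and> set p \<subseteq> V \<and> successively (\<lambda>a b. (a, b) \<in> E) p" for p
  obtain v where v: "v \<in> V" using \<open>V \<noteq> {}\<close> by blast
  have "path [v]" using v by (simp add: path_def)
  moreover have "length p \<le> card V" if "path p" for p
    using that card_mono[OF \<open>finite V\<close>] by (auto simp: path_def distinct_card[symmetric])
  ultimately obtain p\<^sub>0 where p0: "path p\<^sub>0" "\<And>p. path p \<Longrightarrow> length p \<le> length p\<^sub>0"
    using ex_has_greatest_nat[of path "[v]" length "Suc (card V)"]
    by (metis le_imp_less_Suc)
  define N where "N = length p\<^sub>0"
  define longest where "longest p \<longleftrightarrow> path p \<and> length p = N" for p
  have N1: "N \<ge> 1" using p0(2)[OF \<open>path [v]\<close>] by (simp add: N_def)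
  \<comment> \<open>The first node has at least three neighbours, and all of them lie on the path,
    which could otherwise be prolonged. So one remains after any two nodes \<open>a\<close>,
    \<open>b\<close> are excluded.\<close>
  have third: "\<exists>i<N. 1 \<le> i \<and> p ! i \<noteq> a \<and> p ! i \<noteq> b \<and> (p ! 0, p ! i) \<in> E"
    if p: "longest p" for p a b
  proof -
    have pe: "p \<noteq> []" "hd p = p ! 0" using p N1 by (cases p; simp add: longest_def)+
    have "p ! 0 \<in> V" using p N1 by (cases p) (auto simp: longest_def path_def)
    then have "\<not> card {u. (p ! 0, u) \<in> E} \<le> 2" using neg by blast
    moreover have "card {a, b} \<le> 2" by (simp add: card_insert_if)
    ultimately have "\<not> {u. (p ! 0, u) \<in> E} \<subseteq> {a, b}"
      by (meson card_mono finite.emptyI finite.insertI order_trans)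
    then obtain u where u: "(p ! 0, u) \<in> E" "u \<noteq> a" "u \<noteq> b" by blast
    have "u \<in> set p"
    proof (rule ccontr)
      assume "u \<notin> set p"
      then have "path (u # p)"
        using p u EV pe symD[OF E u(1)] by (auto simp: path_def longest_def successively_Cons)
      then show False using p0(2)[of "u # p"] p by (auto simp: longest_def N_def)
    qed
    then obtain i where "i < N" "p ! i = u" using p by (auto simp: in_set_conv_nth longest_def)
    moreover have "i \<noteq> 0" using irr u(1) \<open>p ! i = u\<close> by metis
    ultimately show ?thesis using u by (intro exI[of _ i]) auto
  qed
  define Q where "Q i \<longleftrightarrow> (\<exists>p. longest p \<and> 2 \<le> i \<and> i < N \<and> (p ! 0, p ! i) \<in> E)" for i
  have "longest p\<^sub>0" using p0 by (simp add: longest_def N_def)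
  \<comment> \<open>Excluding the successor \<open>p\<^sub>0 ! 1\<close> leaves a neighbour of index
    at least 2, so \<open>Q\<close> holds somewhere.\<close>
  then obtain i' where "i' < N" "1 \<le> i'" "p\<^sub>0 ! i' \<noteq> p\<^sub>0 ! 1" "(p\<^sub>0 ! 0, p\<^sub>0 ! i') \<in> E"
    using third by blast
  then have "Q i'"
    using \<open>longest p\<^sub>0\<close> by (cases "i' = 1") (auto simp: Q_def)
  define i where "i = (LEAST i. Q i)"
  have "Q i" using \<open>Q i'\<close> unfolding i_def by (rule LeastI)
  have far: "\<exists>j<N. i < j \<and> (p ! 0, p ! j) \<in> E" if "longest p" for p
  proof -
    \<comment> \<open>With the nodes at indices 1 and \<open>i\<close> excluded, the index
      \<open>j\<close> satisfies \<open>Q\<close>, so it is at least \<open>i\<close> and, being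
      different, beyond it.\<close>
    obtain j where j: "j < N" "1 \<le> j" "p ! j \<noteq> p ! 1" "p ! j \<noteq> p ! i" "(p ! 0, p ! j) \<in> E"
      using third[OF \<open>longest p\<close>] by blast
    then have "j \<noteq> 1" "j \<noteq> i" by auto
    with j that have "Q j" by (auto simp: Q_def)
    then have "i \<le> j" unfolding i_def by (rule Least_le)
    with j \<open>j \<noteq> i\<close> show ?thesis by auto
  qed
  obtain p where p: "longest p" "2 \<le> i" "i < N" "(p ! 0, p ! i) \<in> E"
    using \<open>Q i\<close> by (auto simp: Q_def)
  define xs where "xs = take i p"
  define q where "q = drop i p"
  have pq: "p = xs @ q" "length xs = i" "length q = N - i"
    using p by (auto simp: xs_def q_def longest_def)
  have ne: "xs \<noteq> []" "q \<noteq> []" using pq p by auto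
  have hd: "hd xs = p ! 0" "hd q = p ! i"
    using ne pq by (auto simp: hd_conv_nth nth_append)
  have path: "distinct p" "set p \<subseteq> V" "successively (\<lambda>a b. (a, b) \<in> E) xs"
    "successively (\<lambda>a b. (a, b) \<in> E) q" "(last xs, hd q) \<in> E"
    using p(1) ne by (auto simp: longest_def path_def pq(1) successively_append_iff)
  \<comment> \<open>The edge from \<open>p ! 0\<close> to \<open>p ! i\<close> links the reversed
    prefix to \<open>q\<close>; the new first node is \<open>last xs\<close>.\<close>
  have rot: "longest (rev xs @ q)"
    using p path pq ne hd successively_rev_sym[OF E, of xs]
    by (auto simp: longest_def path_def successively_append_iff last_rev simp del: successively_rev)
  \<comment> \<open>Both longest paths agree with \<open>q\<close> from index \<open>i\<close> on,
    hence the shift by \<open>i\<close> in the indices into \<open>q\<close>.\<close>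
  obtain m where m: "m < N" "i < m" "(hd xs, q ! (m - i)) \<in> E"
    using far[OF p(1)] pq hd by (auto simp: nth_append)
  obtain l where l: "l < N" "i < l" "(last xs, q ! (l - i)) \<in> E"
    using far[OF rot] pq ne by (auto simp: nth_append rev_nth last_conv_nth)
  have ind: "1 \<le> m - i" "1 \<le> l - i" "m - i < length q" "l - i < length q"
    using m l pq by auto
  show False
  proof (cases "m \<le> l")
    case True
    then have "m - i \<le> l - i" by simp
    then show False
      using no_path_with_two_chords_from_ends[OF E w cyc, of xs q "m - i" "l - i"] m(3) l(3) ind p pq hd path
      by auto
  next
    case False
    then have "l - i \<le> m - i" by simp
    then show False
      \<comment> \<open>Reversing \<open>xs\<close> exchanges its ends and thereby the roles of
        \<open>m\<close> and \<open>l\<close>.\<close>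
      using no_path_with_two_chords_from_ends[OF E w cyc, of "rev xs" q "l - i" "m - i"]
        m(3) l(3) ind p pq hd path ne successively_rev_sym[OF E, of xs]
      by (auto simp: hd_rev last_rev simp del: successively_rev)
  qed
qed

section \<open>Deletion and suppression of a node\<close>

lemma cycles_2_or_3_mono:
  assumes "cycles_2_or_3 E w" "E' \<subseteq> E"
  shows "cycles_2_or_3 E' w"
proof -
  have "vertex_cycle E p" if "vertex_cycle E' p" for p
    using that assms(2) by (auto simp: vertex_cycle_def elim: successively_mono)
  with assms(1) show ?thesis by (simp add: cycles_2_or_3_def)
qed

text \<open>A cycle through the new edge becomes a cycle of \<open>E\<close> of equal weight when it
  is rerouted through \<open>v\<close>; every other cycle already lies in \<open>E\<close>. As
  \<open>x\<close> and \<open>y\<close> are not adjacent in \<open>E\<close>, the new weight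
  overrides the weight of no old edge.\<close>

lemma cycles_2_or_3_suppress:
  assumes E: "sym E" and w: "\<And>a b. w a b = w b a" and cyc: "cycles_2_or_3 E w"
    and xy: "(x, v) \<in> E" "(v, y) \<in> E" "x \<noteq> v" "y \<noteq> v" "(x, y) \<notin> E"
  shows "cycles_2_or_3 ({(a, b) \<in> E. a \<noteq> v \<and> b \<noteq> v} \<union> {(x, y), (y, x)})
    (\<lambda>a b. if {a, b} = {x, y} then w x v + w v y else w a b)"
    (is "cycles_2_or_3 ?E ?w")
proof -
  have good: "cycle_weight w p mod 4 = 2 \<or> cycle_weight w p mod 4 = 3" if "vertex_cycle E p" for p
    using cyc that by (auto simp: cycles_2_or_3_def)
  note sE = symD[OF E]
  have yx: "(y, x) \<notin> E" using xy(5) sE by blast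
  have new: "{a, b} = {x, y}" if "(a, b) \<in> ?E" "(a, b) \<notin> E" for a b using that by auto
  have weq: "?w a b = w a b" if "(a, b) \<in> E" for a b
    using that xy(5) yx by (auto simp: doubleton_eq_iff)
  have notin: "v \<notin> set p" if "vertex_cycle ?E p" for p
  proof
    assume "v \<in> set p"
    then obtain q r where q: "p = q @ v # r" by (meson split_list)
    show False
    proof (cases "r = []")
      case True
      then show False using that q xy by (auto simp: vertex_cycle_def)
    next
      case False
      then show False using that q xy
        by (auto simp: vertex_cycle_def successively_append_iff successively_Cons)
    qed
  qed
  \<comment> \<open>Here the new edge closes the cycle, and appending \<open>v\<close> to
    \<open>p\<close> reroutes it.\<close>
  have closing: "cycle_weight ?w p mod 4 = 2 \<or> cycle_weight ?w p mod 4 = 3"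
    if p: "vertex_cycle ?E p" and cl: "(last p, hd p) \<notin> E" for p
  proof -
    have lh: "{last p, hd p} = {x, y}" using new cl p by (auto simp: vertex_cycle_def)
    have pne: "p \<noteq> []" and len: "3 \<le> length p" and d: "distinct p"
      using p by (auto simp: vertex_cycle_def)
    \<comment> \<open>The new edge cannot occur a second time: in a distinct list, consecutive nodes
      that are also the two ends of the list force its length to be 2.\<close>
    have suc: "successively (\<lambda>a b. (a, b) \<in> E) p"
    proof (rule ccontr)
      assume "\<not> successively (\<lambda>a b. (a, b) \<in> E) p"
      then obtain q a b r where q: "p = q @ a # b # r" "(a, b) \<notin> E"
        using not_successively_split[of "\<lambda>a b. (a, b) \<in> E" p] by blast
      have "(a, b) \<in> ?E" using p q by (simp add: vertex_cycle_def successively_append_iff)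
      then have "{a, b} = {last p, hd p}" using new q(2) lh by blast
      then show False using q(1) d len
        by (cases q; cases r rule: rev_cases) (auto simp: doubleton_eq_iff)
    qed
    have edges: "(last p, v) \<in> E" "(v, hd p) \<in> E"
      using lh xy sE by (auto simp: doubleton_eq_iff)
    have "vertex_cycle E (p @ [v])"
      using d suc len edges notin[OF p] pne by (auto simp: vertex_cycle_def successively_append_iff)
    moreover have "cycle_weight w (p @ [v]) = cycle_weight ?w p"
    proof -
      have "walk_weight ?w p = walk_weight w p"
        by (rule walk_weight_cong, rule successively_mono[OF suc]) (rule weq)
      moreover have "w (last p) v + w v (hd p) = w x v + w v y"
        using lh w by (auto simp: doubleton_eq_iff)
      ultimately show ?thesis using lh pne by (simp add: cycle_weight_def walk_weight_append)
    qed
    ultimately show ?thesis using good by metis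
  qed
  show ?thesis
    unfolding cycles_2_or_3_def
  proof (intro allI impI)
    fix p assume p: "vertex_cycle ?E p"
    consider "(last p, hd p) \<notin> E"
      | "(last p, hd p) \<in> E" "successively (\<lambda>a b. (a, b) \<in> E) p"
      | q a b r where "p = q @ a # b # r" "(a, b) \<notin> E"
      using not_successively_split[of "\<lambda>a b. (a, b) \<in> E" p] by blast
    then show "cycle_weight ?w p mod 4 = 2 \<or> cycle_weight ?w p mod 4 = 3"
    proof cases
      case 1
      then show ?thesis using closing p by blast
    next
      case 2
      then have "vertex_cycle E p" using p by (auto simp: vertex_cycle_def)
      moreover have "cycle_weight ?w p = cycle_weight w p"
        unfolding cycle_weight_def weq[OF 2(1)]
        by (rule arg_cong2[where f = "(+)"], rule walk_weight_cong, rule successively_mono[OF 2(2)])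
          (rule weq, assumption, rule refl)
      ultimately show ?thesis using good by metis
    next
      case 3
      \<comment> \<open>Rotating to start at \<open>b\<close> and end at \<open>a\<close> makes the
        new edge the closing one.\<close>
      then have "p = (q @ [a]) @ (b # r)" by simp
      then show ?thesis
        using closing[of "(b # r) @ (q @ [a])"] 3(2) p vertex_cycle_rotate[of ?E "q @ [a]" "b # r"]
          cycle_weight_rotate[of ?w "q @ [a]" "b # r"]
        by simp
    qed
  qed
qed

section \<open>Embedding into 2-trees\<close>

inductive two_tree :: "'a set \<Rightarrow> ('a \<times> 'a) set \<Rightarrow> bool" where
  edge: "a \<noteq> b \<Longrightarrow> two_tree {a, b} {(a, b), (b, a)}"
| triangle: "two_tree V F \<Longrightarrow> (x, y) \<in> F \<Longrightarrow> v \<notin> V \<Longrightarrow>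
    two_tree (insert v V) (F \<union> {(x, v), (v, x), (y, v), (v, y)})"

lemma two_tree_graph:
  assumes "two_tree V F"
  shows "finite V" "F \<subseteq> V \<times> V" "sym F" "(a, a) \<notin> F"
  using assms by (induction rule: two_tree.induct) (auto simp: sym_def)

text \<open>Provides an edge at \<open>x\<close> to which a node with \<open>x\<close> as its only
  neighbour can be attached.\<close>

lemma two_tree_neighbour: "two_tree V F \<Longrightarrow> x \<in> V \<Longrightarrow> \<exists>y. (x, y) \<in> F"
  by (induction rule: two_tree.induct) auto

lemma card_le_2_doubletonE:
  assumes "card S \<le> 2" "finite S" "S \<noteq> {}"
  obtains x y where "S = {x, y}"
proof -
  have "card S = 1 \<or> card S = 2" using assms by (auto simp: le_Suc_eq numeral_2_eq_2)
  then show ?thesis using that by (metis card_1_singletonE card_2_iff insert_absorb2)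
qed

text \<open>Induction on the number of nodes: a node of degree at most 2 is removed and later
  attached again to an edge of the 2-tree obtained for the rest. The bound 2 on
  \<open>card V\<close> reflects that the smallest 2-tree is a single edge.\<close>

lemma two_tree_supergraph:
  assumes "finite V" "2 \<le> card V" "E \<subseteq> V \<times> V" "sym E" "\<And>a. (a, a) \<notin> E"
    "\<And>a b. w a b = w b a" "cycles_2_or_3 E w"
  shows "\<exists>F. two_tree V F \<and> E \<subseteq> F"
  using assms
proof (induction "card V" arbitrary: V E w rule: less_induct)
  case less
  note sE = symD[OF \<open>sym E\<close>]
  show ?case
  proof (cases "card V = 2")
    case True
    then obtain a b where "V = {a, b}" "a \<noteq> b" by (auto simp: card_2_iff)
    moreover have "E \<subseteq> {(a, b), (b, a)}" using less.prems(3,5) calculation by auto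
    ultimately show ?thesis using two_tree.edge[of a b] by metis
  next
    case False
    then have card: "3 \<le> card V" using less.prems(2) by simp
    obtain v where v: "v \<in> V" and deg: "card {u. (v, u) \<in> E} \<le> 2"
      using degree_le_2_vertex[of V E w] less.prems by (metis card.empty not_numeral_le_zero)
    define V' where "V' = V - {v}"
    define E' where "E' = {(a, b) \<in> E. a \<noteq> v \<and> b \<noteq> v}"
    have V': "finite V'" "card V' < card V" "2 \<le> card V'" "v \<notin> V'" "insert v V' = V"
      using v card less.prems(1) by (auto simp: V'_def)
    have E': "E' \<subseteq> V' \<times> V'" "sym E'" "\<And>a. (a, a) \<notin> E'" "E' \<subseteq> E"
      using less.prems(3,5) sE by (auto simp: V'_def E'_def sym_def)
    have IH: "\<exists>F. two_tree V' F \<and> E'' \<subseteq> F"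
      if "E'' \<subseteq> V' \<times> V'" "sym E''" "\<And>a. (a, a) \<notin> E''" "\<And>a b. w'' a b = w'' b a"
        "cycles_2_or_3 E'' w''" for E'' and w'' :: "'a \<Rightarrow> 'a \<Rightarrow> nat"
      using less.hyps[OF V'(2,1,3) that] .
    have nb: "u \<in> V'" if "(v, u) \<in> E" for u
      using that less.prems(3,5) by (auto simp: V'_def)
    have add: ?thesis if F: "two_tree V' F" "E' \<subseteq> F" "(x, y) \<in> F" and S: "{u. (v, u) \<in> E} \<subseteq> {x, y}"
      for F x y
    proof -
      have "two_tree V (F \<union> {(x, v), (v, x), (y, v), (v, y)})"
        using two_tree.triangle[OF F(1,3) V'(4)] V'(5) by simp
      moreover have "E \<subseteq> F \<union> {(x, v), (v, x), (y, v), (v, y)}"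
        using F(2) S sE by (fastforce simp: E'_def)
      ultimately show ?thesis by blast
    qed
    have cyc': "cycles_2_or_3 E' w" using cycles_2_or_3_mono less.prems(7) E'(4) by blast
    \<comment> \<open>The missing second neighbour is replaced by any neighbour \<open>y\<close> of
      \<open>x\<close> in the 2-tree; a node without neighbours is treated alike, with an arbitrary
      \<open>x\<close>.\<close>
    have one: ?thesis if S: "{u. (v, u) \<in> E} \<subseteq> {x}" and x: "x \<in> V'" for x
    proof -
      obtain F where F: "two_tree V' F" "E' \<subseteq> F" using IH[OF E'(1-3) less.prems(6) cyc'] by metis
      obtain y where "(x, y) \<in> F" using two_tree_neighbour[OF F(1) x] by blast
      then show ?thesis using add[OF F, of x y] S by auto
    qed
    show ?thesis
    proof (cases "{u. (v, u) \<in> E} = {}")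
      case True
      moreover obtain x where "x \<in> V'" using V' by (metis card.empty ex_in_conv not_numeral_le_zero)
      ultimately show ?thesis using one[of x] by simp
    next
      case False
      have "finite {u. (v, u) \<in> E}" by (rule finite_subset[OF _ V'(1)]) (use nb in auto)
      then obtain x y where S: "{u. (v, u) \<in> E} = {x, y}" using card_le_2_doubletonE[OF deg _ False] by metis
      have xy: "(x, v) \<in> E" "(v, y) \<in> E" "x \<in> V'" "y \<in> V'" using S nb sE by blast+
      show ?thesis
      proof (cases "x = y")
        case True
        then show ?thesis using one[of x] S xy by simp
      next
        case False
        show ?thesis
        proof (cases "(x, y) \<in> E")
          case True
          \<comment> \<open>Deleting \<open>v\<close> suffices, since the edge needed for attaching
            it again survives.\<close>
          then have "(x, y) \<in> E'" using xy V'(4) by (auto simp: E'_def)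
          moreover obtain F where F: "two_tree V' F" "E' \<subseteq> F"
            using IH[OF E'(1-3) less.prems(6) cyc'] by metis
          ultimately show ?thesis using add[OF F, of x y] S by auto
        next
          case nonadj: False
          \<comment> \<open>Suppressing \<open>v\<close> forces the edge between \<open>x\<close>
            and \<open>y\<close> into the 2-tree.\<close>
          have "\<exists>F. two_tree V' F \<and> E' \<union> {(x, y), (y, x)} \<subseteq> F"
          proof (rule IH)
            show "cycles_2_or_3 (E' \<union> {(x, y), (y, x)})
                (\<lambda>a b. if {a, b} = {x, y} then w x v + w v y else w a b)"
              unfolding E'_def
              using xy V'(4) nonadj by (intro cycles_2_or_3_suppress less.prems) auto
          qed (use E' xy False less.prems(6) in \<open>auto simp: sym_def insert_commute\<close>)
          then obtain F where "two_tree V' F" "E' \<subseteq> F" "(x, y) \<in> F" by auto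
          then show ?thesis using add[of F x y] S by simp
        qed
      qed
    qed
  qed
qed

section \<open>Straight-line drawings of 2-trees\<close>

text \<open>
  The point at distance \<open>t * dist X Y\<close> from the midpoint on the perpendicular bisector, on the left
  of the directed segment for \<open>t > 0\<close>.
\<close>

definition near_midpoint :: "complex \<Rightarrow> complex \<Rightarrow> real \<Rightarrow> complex" where
  "near_midpoint X Y t = X + (Y - X) * Complex (1/2) t"

lemma near_midpoint_commute: "near_midpoint X Y t = near_midpoint Y X (- t)"
  by (simp add: near_midpoint_def complex_eq_iff algebra_simps)

text \<open>The vector from \<open>X\<close> to the common point \<open>p\<close> is a positive
  multiple of both directions.\<close>

lemma closed_segment_same_start:
  fixes X b z :: complex
  assumes "p \<in> closed_segment X b" "p \<in> closed_segment X z" "p \<noteq> X"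
  obtains r where "r > 0" "z - X = of_real r * (b - X)"
proof -
  obtain u where u: "0 \<le> u" "u \<le> 1" "p - X = of_real u * (b - X)"
    using assms(1) by (auto simp: in_segment algebra_simps scaleR_conv_of_real)
  obtain s where s: "0 \<le> s" "s \<le> 1" "p - X = of_real s * (z - X)"
    using assms(2) by (auto simp: in_segment algebra_simps scaleR_conv_of_real)
  have "u \<noteq> 0" "s \<noteq> 0" using u s assms(3) by auto
  then have "z - X = of_real (u / s) * (b - X)" using u s by (simp add: field_simps)
  with u s \<open>u \<noteq> 0\<close> \<open>s \<noteq> 0\<close> show ?thesis using that[of "u / s"] by simp
qed

text \<open>As \<open>t\<close> varies, the direction from \<open>X\<close> to the new point
  changes, and it agrees with the direction to \<open>c\<close> for at most one
  \<open>t\<close>.\<close>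

lemma eventually_segment_near_midpoint_same_start:
  assumes XY: "X \<noteq> Y"
  shows "\<forall>\<^sub>F t in at 0. closed_segment X (near_midpoint X Y t) \<inter> closed_segment X c \<subseteq> {X}"
proof -
  define d where "d = (c - X) / (Y - X)"
  have cd: "c - X = (Y - X) * d" using XY by (simp add: d_def)
  \<comment> \<open>In units of \<open>Y - X\<close> the directions are
    \<open>Complex (1/2) t\<close> and \<open>d\<close>; they can be parallel only for the excluded
    \<open>t\<close>. If \<open>Re d = 0\<close> they are never positively parallel, and the
    quotient is 0 by convention, a value that the filter \<open>at 0\<close> ignores anyway.\<close>
  have "closed_segment X (near_midpoint X Y t) \<inter> closed_segment X c \<subseteq> {X}"
    if t: "t \<noteq> Im d / (2 * Re d)" for t
  proof (rule ccontr)
    assume "\<not> ?thesis"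
    then obtain p where "p \<in> closed_segment X c" "p \<in> closed_segment X (near_midpoint X Y t)" "p \<noteq> X"
      by blast
    then obtain r where r: "r > 0" "near_midpoint X Y t - X = of_real r * (c - X)"
      by (rule closed_segment_same_start)
    then have "(Y - X) * Complex (1/2) t = (Y - X) * (of_real r * d)"
      by (simp add: near_midpoint_def cd)
    then have "Complex (1/2) t = of_real r * d" using XY by simp
    then have "1/2 = r * Re d" "t = r * Im d" by (simp_all add: complex_eq_iff)
    moreover have "Re d = 1 / (2 * r)" using calculation(1) r(1) by (simp add: field_simps)
    ultimately show False using t by simp
  qed
  then show ?thesis
    by (rule eventually_mono[OF eventually_neq_at_within])
qed

text \<open>If \<open>X\<close> is an end of the obstacle, only directions matter. Otherwise the
  half segment from \<open>X\<close> to the midpoint misses the obstacle, by compactness with a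
  positive distance, and a small move of its far end keeps them apart.\<close>

lemma eventually_segment_near_midpoint:
  assumes XY: "X \<noteq> Y" and S: "closed_segment a b \<inter> closed_segment X Y \<subseteq> {X, Y}"
    and ends: "X \<in> closed_segment a b \<Longrightarrow> X = a \<or> X = b"
  shows "\<forall>\<^sub>F t in at 0. closed_segment X (near_midpoint X Y t) \<inter> closed_segment a b \<subseteq> {X}"
proof -
  show ?thesis
  proof (cases "X \<in> closed_segment a b")
    case True
    then show ?thesis using ends eventually_segment_near_midpoint_same_start[OF XY] closed_segment_commute by metis
  next
    case False
    define M where "M = near_midpoint X Y 0"
    have M: "M = midpoint X Y"
      by (simp add: M_def near_midpoint_def midpoint_def complex_eq_iff algebra_simps)
    have "closed_segment X M \<subseteq> closed_segment X Y"
      by (simp add: M subset_closed_segment)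
    moreover have "Y \<notin> closed_segment X M"
    proof
      assume "Y \<in> closed_segment X M"
      then have "dist X Y \<le> dist X M" using dist_in_closed_segment by (metis dist_commute)
      then show False using XY by (simp add: M dist_midpoint)
    qed
    ultimately have "closed_segment X M \<inter> closed_segment a b = {}" using S False by blast
    then obtain \<delta> where \<delta>: "\<delta> > 0" "\<And>x y. x \<in> closed_segment X M \<Longrightarrow> y \<in> closed_segment a b \<Longrightarrow> \<delta> \<le> dist x y"
      using separate_compact_closed[of "closed_segment X M" "closed_segment a b"] by auto
    have "((\<lambda>t. near_midpoint X Y t) \<longlongrightarrow> M) (at 0)"
      unfolding M_def near_midpoint_def Complex_eq by (intro tendsto_intros)
    then have "\<forall>\<^sub>F t in at 0. dist (near_midpoint X Y t) M < \<delta>" using \<delta>(1) by (rule tendstoD)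
    then show ?thesis
    proof (rule eventually_mono)
      fix t assume t: "dist (near_midpoint X Y t) M < \<delta>"
      have False if p: "p \<in> closed_segment X (near_midpoint X Y t)" "p \<in> closed_segment a b" for p
      proof -
        obtain u where u: "0 \<le> u" "u \<le> 1" "p = (1 - u) *\<^sub>R X + u *\<^sub>R near_midpoint X Y t"
          using p(1) by (auto simp: in_segment)
        \<comment> \<open>The point with the same parameter on the unperturbed segment; it lies no
          farther from \<open>p\<close> than the midpoint lies from the moved end.\<close>
        define p' where "p' = (1 - u) *\<^sub>R X + u *\<^sub>R M"
        have "p' \<in> closed_segment X M" using u by (auto simp: in_segment p'_def)
        then have "\<delta> \<le> dist p' p" using \<delta>(2) p(2) by blast
        also have "dist p' p = u * dist (near_midpoint X Y t) M"
          using u by (simp add: dist_norm p'_def norm_minus_commute flip: scaleR_diff_right)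
        also have "\<dots> \<le> dist (near_midpoint X Y t) M"
          using u by (simp add: mult_left_le_one_le)
        finally show False using t by simp
      qed
      then show "closed_segment X (near_midpoint X Y t) \<inter> closed_segment a b \<subseteq> {X}" by blast
    qed
  qed
qed

definition straight_drawing :: "'a set \<Rightarrow> ('a \<times> 'a) set \<Rightarrow> ('a \<Rightarrow> complex) \<Rightarrow> bool" where
  "straight_drawing V F \<phi> \<longleftrightarrow> inj_on \<phi> V \<and>
     (\<forall>(a, b) \<in> F. closed_segment (\<phi> a) (\<phi> b) \<inter> \<phi> ` V \<subseteq> {\<phi> a, \<phi> b}) \<and>
     (\<forall>(a, b) \<in> F. \<forall>(c, d) \<in> F. {a, b} \<noteq> {c, d} \<longrightarrow>
        closed_segment (\<phi> a) (\<phi> b) \<inter> closed_segment (\<phi> c) (\<phi> d) \<subseteq> \<phi> ` V)"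

lemma straight_drawingI:
  assumes "inj_on \<phi> V"
    and "\<And>a b. (a, b) \<in> F \<Longrightarrow> closed_segment (\<phi> a) (\<phi> b) \<inter> \<phi> ` V \<subseteq> {\<phi> a, \<phi> b}"
    and "\<And>a b c d. (a, b) \<in> F \<Longrightarrow> (c, d) \<in> F \<Longrightarrow> {a, b} \<noteq> {c, d} \<Longrightarrow>
      closed_segment (\<phi> a) (\<phi> b) \<inter> closed_segment (\<phi> c) (\<phi> d) \<subseteq> \<phi> ` V"
  shows "straight_drawing V F \<phi>"
  unfolding straight_drawing_def
  by (intro conjI ballI, rule assms(1), unfold split_beta,
      metis assms(2) prod.collapse, metis assms(3) prod.collapse)

lemma straight_drawingD:
  assumes "straight_drawing V F \<phi>"
  shows "inj_on \<phi> V"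
    and "(a, b) \<in> F \<Longrightarrow> closed_segment (\<phi> a) (\<phi> b) \<inter> \<phi> ` V \<subseteq> {\<phi> a, \<phi> b}"
    and "(a, b) \<in> F \<Longrightarrow> (c, d) \<in> F \<Longrightarrow> {a, b} \<noteq> {c, d} \<Longrightarrow>
      closed_segment (\<phi> a) (\<phi> b) \<inter> closed_segment (\<phi> c) (\<phi> d) \<subseteq> \<phi> ` V"
  using assms unfolding straight_drawing_def by blast+

text \<open>The new node is put near the midpoint of the edge between \<open>x\<close> and
  \<open>y\<close>. There are finitely many nodes and edges, and each is avoided for all small
  nonzero \<open>t\<close>, so some \<open>t\<close> serves for all of them.\<close>

lemma straight_drawing_extend:
  assumes dr: "straight_drawing V F \<phi>" and fin: "finite V" and FV: "F \<subseteq> V \<times> V" and irr: "\<And>a. (a, a) \<notin> F"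
    and xy: "(x, y) \<in> F" and v: "v \<notin> V"
  shows "\<exists>\<psi>. straight_drawing (insert v V) (F \<union> {(x, v), (v, x), (y, v), (v, y)}) \<psi>"
proof -
  define X Y where "X = \<phi> x" and "Y = \<phi> y"
  note inj = straight_drawingD(1)[OF dr] and verts = straight_drawingD(2)[OF dr]
    and cross = straight_drawingD(3)[OF dr]
  have xyV: "x \<in> V" "y \<in> V" "x \<noteq> y" using xy FV irr by auto
  then have XY: "X \<noteq> Y" using inj by (auto simp: X_def Y_def inj_on_def)
  have XYV: "X \<in> \<phi> ` V" "Y \<in> \<phi> ` V" using xyV by (auto simp: X_def Y_def)
  let ?z = "near_midpoint X Y"
  \<comment> \<open>Exchanging \<open>X\<close> and \<open>Y\<close> negates \<open>t\<close>, and
    \<open>at 0\<close> is invariant under negation; so facts about the end \<open>X\<close> carry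
    over to \<open>Y\<close>.\<close>
  have near_Y: "\<forall>\<^sub>F t in at 0. P (?z t)" if "\<forall>\<^sub>F t in at 0. P (near_midpoint Y X t)" for P
  proof -
    have "\<forall>\<^sub>F t in filtermap uminus (at 0). P (near_midpoint Y X t)"
      using that filtermap_at_minus[of "0 :: real"] by simp
    then show ?thesis by (simp add: eventually_filtermap near_midpoint_commute[of X Y])
  qed
  have near: "\<forall>\<^sub>F t in at 0. closed_segment X (?z t) \<inter> closed_segment a b \<subseteq> {X} \<and>
      closed_segment Y (?z t) \<inter> closed_segment a b \<subseteq> {Y}"
    if S: "closed_segment a b \<inter> closed_segment X Y \<subseteq> {X, Y}"
      and ends: "closed_segment a b \<inter> {X, Y} \<subseteq> {a, b}" for a b
  proof (rule eventually_conj)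
    show "\<forall>\<^sub>F t in at 0. closed_segment X (?z t) \<inter> closed_segment a b \<subseteq> {X}"
      using S ends by (intro eventually_segment_near_midpoint XY) auto
    show "\<forall>\<^sub>F t in at 0. closed_segment Y (?z t) \<inter> closed_segment a b \<subseteq> {Y}"
      using S ends XY
      by (intro near_Y eventually_segment_near_midpoint) (auto simp: closed_segment_commute[of Y X])
  qed
  have near_edge: "\<forall>\<^sub>F t in at 0. closed_segment X (?z t) \<inter> closed_segment (\<phi> a) (\<phi> b) \<subseteq> {X} \<and>
      closed_segment Y (?z t) \<inter> closed_segment (\<phi> a) (\<phi> b) \<subseteq> {Y}"
    if ab: "(a, b) \<in> F" for a b
  proof (cases "{a, b} = {x, y}")
    \<comment> \<open>The edge between \<open>x\<close> and \<open>y\<close> overlaps the whole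
      segment, so \<open>near\<close> does not apply; comparing directions at each end does.\<close>
    case True
    then have eq: "closed_segment (\<phi> a) (\<phi> b) = closed_segment X Y"
      unfolding X_def Y_def doubleton_eq_iff using closed_segment_commute by metis
    show ?thesis unfolding eq
    proof (rule eventually_conj)
      show "\<forall>\<^sub>F t in at 0. closed_segment X (?z t) \<inter> closed_segment X Y \<subseteq> {X}"
        by (rule eventually_segment_near_midpoint_same_start[OF XY])
      show "\<forall>\<^sub>F t in at 0. closed_segment Y (?z t) \<inter> closed_segment X Y \<subseteq> {Y}"
        using eventually_segment_near_midpoint_same_start[OF XY[symmetric], of X]
        by (intro near_Y) (simp add: closed_segment_commute[of X Y])
    qed
  next
    case False
    show ?thesis
    proof (rule near)
      show "closed_segment (\<phi> a) (\<phi> b) \<inter> closed_segment X Y \<subseteq> {X, Y}"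
        using cross[OF ab xy False] verts[OF xy] by (auto simp: X_def Y_def)
      show "closed_segment (\<phi> a) (\<phi> b) \<inter> {X, Y} \<subseteq> {\<phi> a, \<phi> b}"
        using verts[OF ab] XYV by auto
    qed
  qed
  have near_vertex: "\<forall>\<^sub>F t in at 0. closed_segment X (?z t) \<inter> {\<phi> u} \<subseteq> {X} \<and>
      closed_segment Y (?z t) \<inter> {\<phi> u} \<subseteq> {Y}" if "u \<in> V" for u
    \<comment> \<open>A node is treated as a degenerate segment.\<close>
    using near[of "\<phi> u" "\<phi> u"] verts[OF xy] that by (auto simp: X_def Y_def)
  have "finite F" using finite_subset[OF FV] fin by blast
  have "\<forall>\<^sub>F t in at 0. t \<noteq> 0 \<and>
      (\<forall>e\<in>F. closed_segment X (?z t) \<inter> closed_segment (\<phi> (fst e)) (\<phi> (snd e)) \<subseteq> {X} \<and>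
        closed_segment Y (?z t) \<inter> closed_segment (\<phi> (fst e)) (\<phi> (snd e)) \<subseteq> {Y}) \<and>
      (\<forall>u\<in>V. closed_segment X (?z t) \<inter> {\<phi> u} \<subseteq> {X} \<and> closed_segment Y (?z t) \<inter> {\<phi> u} \<subseteq> {Y})"
    using near_edge near_vertex \<open>finite F\<close> fin
    by (intro eventually_conj eventually_ball_finite eventually_neq_at_within) auto
  from eventually_happens'[OF at_neq_bot this] obtain t where t: "t \<noteq> 0"
    and edges: "\<forall>e\<in>F. closed_segment X (?z t) \<inter> closed_segment (\<phi> (fst e)) (\<phi> (snd e)) \<subseteq> {X} \<and>
      closed_segment Y (?z t) \<inter> closed_segment (\<phi> (fst e)) (\<phi> (snd e)) \<subseteq> {Y}"
    and vertices: "\<forall>u\<in>V. closed_segment X (?z t) \<inter> {\<phi> u} \<subseteq> {X} \<and> closed_segment Y (?z t) \<inter> {\<phi> u} \<subseteq> {Y}"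
    by (elim exE conjE)
  note vertex = bspec[OF vertices]
  have edge: "closed_segment X (?z t) \<inter> closed_segment (\<phi> a) (\<phi> b) \<subseteq> {X} \<and>
      closed_segment Y (?z t) \<inter> closed_segment (\<phi> a) (\<phi> b) \<subseteq> {Y}" if "(a, b) \<in> F" for a b
    using bspec[OF edges that] by simp
  define z where "z = ?z t"
  define \<psi> where "\<psi> = \<phi>(v := z)"
  have zXY: "z \<in> closed_segment X z" "z \<in> closed_segment Y z" by auto
  note vertex = vertex[folded z_def] and edge = edge[folded z_def]
  \<comment> \<open>\<open>z\<close> lies on both new segments, so an old node or edge containing it
    would force \<open>z = X\<close> and \<open>z = Y\<close>.\<close>
  have zV: "z \<notin> \<phi> ` V"
  proof
    assume "z \<in> \<phi> ` V"
    then obtain u where "u \<in> V" "z = \<phi> u" by blast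
    then have "z = X" "z = Y" using vertex[of u] zXY by auto
    then show False using XY by simp
  qed
  have zF: "z \<notin> closed_segment (\<phi> a) (\<phi> b)" if "(a, b) \<in> F" for a b
    using edge[OF that] XY zXY by auto
  have XzY: "closed_segment X z \<inter> closed_segment Y z \<subseteq> {z}"
  proof (rule ccontr)
    assume "\<not> ?thesis"
    then obtain p where "p \<in> closed_segment z Y" "p \<in> closed_segment z X" "p \<noteq> z"
      using closed_segment_commute[of z] by blast
    then obtain r where r: "X - z = of_real r * (Y - z)" by (rule closed_segment_same_start)
    \<comment> \<open>After cancelling \<open>Y - X\<close>, the real parts give
      \<open>r = -1\<close> and then the imaginary parts give \<open>t = 0\<close>.\<close>
    have "(Y - X) * (- Complex (1/2) t) = (Y - X) * (of_real r * (1 - Complex (1/2) t))"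
      using r by (simp add: z_def near_midpoint_def algebra_simps)
    then have "- Complex (1/2) t = of_real r * (1 - Complex (1/2) t)"
      using XY by (simp only: mult_left_cancel right_minus_eq)
    then show False using t by (simp add: complex_eq_iff)
  qed
  have \<psi>V: "\<psi> a = \<phi> a" if "a \<in> V" for a using that v by (auto simp: \<psi>_def)
  have img: "\<psi> ` insert v V = insert z (\<phi> ` V)"
    using v by (auto simp: \<psi>_def image_iff)
  have old: "closed_segment (\<psi> a) (\<psi> b) = closed_segment (\<phi> a) (\<phi> b)" "\<psi> a = \<phi> a" "\<psi> b = \<phi> b"
    if "(a, b) \<in> F" for a b
    using that FV \<psi>V by auto
  let ?N = "{(x, v), (v, x), (y, v), (v, y)}"
  have new: "closed_segment (\<psi> a) (\<psi> b) = closed_segment X z \<and> {\<psi> a, \<psi> b} = {X, z} \<and> {a, b} = {x, v} \<or>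
      closed_segment (\<psi> a) (\<psi> b) = closed_segment Y z \<and> {\<psi> a, \<psi> b} = {Y, z} \<and> {a, b} = {y, v}"
    if "(a, b) \<in> ?N" for a b
    using that xyV v closed_segment_commute[of z] by (auto simp: \<psi>_def X_def Y_def)
  have "inj_on \<psi> (insert v V)"
    using inj zV v by (auto simp: \<psi>_def inj_on_def)
  moreover have "closed_segment (\<psi> a) (\<psi> b) \<inter> \<psi> ` insert v V \<subseteq> {\<psi> a, \<psi> b}"
    if "(a, b) \<in> F \<union> ?N" for a b
    using that
  proof
    assume "(a, b) \<in> F"
    then show ?thesis unfolding img old[OF \<open>(a, b) \<in> F\<close>] using verts zF by blast
  next
    assume "(a, b) \<in> ?N"
    then show ?thesis unfolding img using new[OF \<open>(a, b) \<in> ?N\<close>] vertex by fast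
  qed
  moreover have "closed_segment (\<psi> a) (\<psi> b) \<inter> closed_segment (\<psi> c) (\<psi> d) \<subseteq> \<psi> ` insert v V"
    if abcd: "(a, b) \<in> F \<union> ?N" "(c, d) \<in> F \<union> ?N" and ne: "{a, b} \<noteq> {c, d}" for a b c d
  proof -
    have mixed: "closed_segment (\<psi> a) (\<psi> b) \<inter> closed_segment (\<psi> c) (\<psi> d) \<subseteq> \<psi> ` insert v V"
      if "(a, b) \<in> F" "(c, d) \<in> ?N" for a b c d
      unfolding img old[OF that(1)] using new[OF that(2)] edge[OF that(1)] XYV by blast
    consider "(a, b) \<in> F" "(c, d) \<in> F" | "(a, b) \<in> F" "(c, d) \<in> ?N" | "(a, b) \<in> ?N" "(c, d) \<in> F"
      | "(a, b) \<in> ?N" "(c, d) \<in> ?N" using abcd by (metis Un_iff)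
    then show ?thesis
    proof cases
      case 1
      show ?thesis unfolding img old(1)[OF 1(1)] old(1)[OF 1(2)] using cross[OF 1 ne] by blast
    next
      case 2
      then show ?thesis by (rule mixed)
    next
      case 3
      then show ?thesis using mixed[of c d a b] by (simp add: Int_commute)
    next
      case 4
      \<comment> \<open>Two different new edges are one from \<open>X\<close> and one from
        \<open>Y\<close>.\<close>
      have "closed_segment (\<psi> a) (\<psi> b) \<inter> closed_segment (\<psi> c) (\<psi> d) \<subseteq> {z}"
        using new[OF 4(1)] new[OF 4(2)] ne XzY Int_commute by metis
      then show ?thesis unfolding img by blast
    qed
  qed
  ultimately have "straight_drawing (insert v V) (F \<union> ?N) \<psi>" by (rule straight_drawingI)
  then show ?thesis by blast
qed

lemma two_tree_straight_drawing: "two_tree V F \<Longrightarrow> \<exists>\<phi>. straight_drawing V F \<phi>"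
proof (induction rule: two_tree.induct)
  case (edge a b)
  then have "straight_drawing {a, b} {(a, b), (b, a)} (\<lambda>u. if u = a then 0 else 1)"
    by (auto simp: straight_drawing_def inj_on_def)
  then show ?case by blast
next
  case (triangle V F x y v)
  then show ?case using straight_drawing_extend two_tree_graph by metis
qed

text \<open>Omitting edges creates no crossings, and \<open>linepath\<close> between distinct points
  is an arc whose reversal exchanges the two points.\<close>

lemma planar_if_straight_drawing:
  assumes dr: "straight_drawing (pverts G) F \<phi>" and F: "parcs G \<subseteq> F"
    and G: "parcs G \<subseteq> pverts G \<times> pverts G" and irr: "\<And>a. (a, a) \<notin> parcs G"
  shows "planar G"
proof -
  let ?g = "\<lambda>e. linepath (\<phi> (fst e)) (\<phi> (snd e))"
  have inj: "inj_on \<phi> (pverts G)" using dr by (rule straight_drawingD)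
  have "arc (?g (u, v)) \<and> pathstart (?g (u, v)) = \<phi> u \<and> pathfinish (?g (u, v)) = \<phi> v \<and>
      ?g (v, u) = reversepath (?g (u, v)) \<and> path_image (?g (u, v)) \<inter> \<phi> ` pverts G = {\<phi> u, \<phi> v}"
    if uv: "(u, v) \<in> parcs G" for u v
  proof -
    have "u \<in> pverts G" "v \<in> pverts G" "u \<noteq> v" using uv G irr by auto
    then have "\<phi> u \<noteq> \<phi> v" using inj by (auto simp: inj_on_def)
    moreover have "closed_segment (\<phi> u) (\<phi> v) \<inter> \<phi> ` pverts G \<subseteq> {\<phi> u, \<phi> v}"
      using straight_drawingD(2)[OF dr] uv F by blast
    ultimately show ?thesis
      using \<open>u \<in> pverts G\<close> \<open>v \<in> pverts G\<close> by auto
  qed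
  moreover have "path_image (?g e) \<inter> path_image (?g f) \<subseteq> \<phi> ` pverts G"
    if e: "e \<in> parcs G" "f \<in> parcs G" "f \<noteq> e \<and> f \<noteq> prod.swap e" for e f
  proof -
    obtain a b c d where ef: "e = (a, b)" "f = (c, d)" by (cases e, cases f)
    then have "{a, b} \<noteq> {c, d}" using e(3) by (auto simp: doubleton_eq_iff)
    moreover have "(a, b) \<in> F" "(c, d) \<in> F" using e ef F by auto
    ultimately show ?thesis using straight_drawingD(3)[OF dr] ef by simp
  qed
  ultimately have "plane_embedding G \<phi> ?g"
    unfolding plane_embedding_def using inj by blast
  then show ?thesis unfolding planar_def by blast
qed

section \<open>Cycles as node lists and as arc lists\<close>

lemma awalk_of_vertices:
  fixes G :: "'a pair_pre_digraph"
  assumes "p \<noteq> []"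
  shows "pre_digraph.cas (with_proj G) (hd p) (zip p (tl p)) (last p)"
    and "pre_digraph.awalk_verts (with_proj G) (hd p) (zip p (tl p)) = p"
  using assms
  by (induction p rule: induct_list012)
    (simp_all add: pre_digraph.cas.simps pre_digraph.awalk_verts.simps)

lemma successively_imp_zip_subset:
  "successively (\<lambda>a b. (a, b) \<in> E) p \<Longrightarrow> set (zip p (tl p)) \<subseteq> E"
  by (induction p rule: induct_list012) auto

text \<open>Transfers the condition on cycle lengths from arc lists to node lists.\<close>

lemma graph_cycle_if_vertex_cycle:
  assumes "vertex_cycle (parcs G) p" and G: "parcs G \<subseteq> pverts G \<times> pverts G"
  shows "\<exists>q. graph_cycle G q \<and> length q = length p"
proof -
  \<comment> \<open>Repeating the first node at the end makes the zip include the closing arc, so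
    \<open>q\<close> has as many arcs as \<open>p\<close> has nodes.\<close>
  define c where "c = p @ [hd p]"
  define q where "q = zip c (tl c)"
  have p: "distinct p" "3 \<le> length p" "successively (\<lambda>a b. (a, b) \<in> parcs G) p"
    "(last p, hd p) \<in> parcs G" "p \<noteq> []"
    using assms(1) by (auto simp: vertex_cycle_def)
  have c: "c \<noteq> []" "hd c = hd p" "last c = hd p" "tl c = tl p @ [hd p]"
    using p(5) by (auto simp: c_def)
  have len: "length q = length p" using p(5) by (simp add: q_def c c_def)
  have "successively (\<lambda>a b. (a, b) \<in> parcs G) c"
    using p by (simp add: c_def successively_append_iff)
  then have "set q \<subseteq> parcs G" unfolding q_def by (rule successively_imp_zip_subset)
  moreover have "distinct (tl c)" using p(1,5) by (cases p) (auto simp: c)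
  moreover have "hd p \<in> pverts G" using p(4) G by auto
  ultimately have "pre_digraph.cycle (with_proj G) q"
    using awalk_of_vertices[OF c(1), of G, folded q_def] len p(2) unfolding c(2,3)
    by (auto simp: pre_digraph.cycle_def pre_digraph.awalk_def intro!: exI[of _ "hd p"])
  then show ?thesis using len p(2) by (auto simp: graph_cycle_def)
qed

lemma walk_weight_one: "p \<noteq> [] \<Longrightarrow> Suc (walk_weight (\<lambda>_ _. 1) p) = length p"
  by (induction p rule: induct_list012) auto

theorem mainTheorem20:
  fixes G :: "'a pair_pre_digraph"
  assumes "G \<in> eps23"
  shows "planar G"
proof -
  have "pair_graph G" using assms by (simp add: eps23_def euler_graph_def)
  then interpret pair_graph G .
  let ?w = "\<lambda>_ _. 1 :: nat"
  have "(a, a) \<notin> parcs G" for a using pair_no_loops[of "(a, a)"] by auto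
  then have G: "parcs G \<subseteq> pverts G \<times> pverts G" "\<And>a. (a, a) \<notin> parcs G" "finite (pverts G)"
    using in_arcsD1 in_arcsD2 pair_finite_verts by auto
  have sym: "sym (parcs G)" using pair_sym_arcs by (simp add: symmetric_def)
  have cyc: "cycles_2_or_3 (parcs G) ?w"
    unfolding cycles_2_or_3_def
  proof (intro allI impI)
    fix p assume p: "vertex_cycle (parcs G) p"
    \<comment> \<open>A walk has one edge fewer than nodes; the closing edge makes up the
      difference.\<close>
    then have "cycle_weight ?w p = length p"
      using walk_weight_one[of p] by (cases "p = []") (auto simp: cycle_weight_def vertex_cycle_def)
    moreover obtain q where "graph_cycle G q" "length q = length p"
      using graph_cycle_if_vertex_cycle[OF p G(1)] by blast
    ultimately show "cycle_weight ?w p mod 4 = 2 \<or> cycle_weight ?w p mod 4 = 3"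
      using assms by (auto simp: eps23_def)
  qed
  have "\<exists>\<phi> F. straight_drawing (pverts G) F \<phi> \<and> parcs G \<subseteq> F"
  proof (cases "2 \<le> card (pverts G)")
    case True
    then show ?thesis
      using two_tree_supergraph[of "pverts G" "parcs G" ?w] G \<open>sym (parcs G)\<close> cyc
        two_tree_straight_drawing by metis
  next
    \<comment> \<open>No 2-tree has fewer than two nodes; such a graph has no edges and is drawn
      directly.\<close>
    case False
    then have one: "a = b" if "a \<in> pverts G" "b \<in> pverts G" for a b
      using that G(3) card_mono[of "pverts G" "{a, b}"] by (cases "a = b") auto
    then have "parcs G = {}" using G(1,2) by fastforce
    moreover have "straight_drawing (pverts G) {} (\<lambda>_. 0)"
      using one by (auto simp: straight_drawing_def inj_on_def)
    ultimately show ?thesis by auto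
  qed
  then show ?thesis using planar_if_straight_drawing G by metis
qed

end
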